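(* Let $\mathcal G$ be a compact, connected, finite metric graph with vertex set $\mathsf V$ and total length $|\mathcal G|$. For any subset $\emptyset\ne\mathsf V_{\mathrm D}\subset\mathsf V$ there holds \[ \lambda_1(\mathcal G;\mathsf V_{\mathrm D})\,T(\mathcal G;\mathsf V_{\mathrm D})<|\mathcal G| . \]
   Context: A compact, connected, finite metric graph consists of finitely many edges $\mathsf e\simeq[0,\ell_{\mathsf e}]$, $0<\ell_{\mathsf e}<\infty$, glued at their endpoints (vertices) to form a connected space; $|\mathcal G|=\sum_{\mathsf e}\ell_{\mathsf e}$. $H^1_0(\mathcal G;\mathsf V_{\mathrm D})$ is the space of continuous functions on $\mathcal G$ that are edgewise $H^1$ and vanish on $\mathsf V_{\mathrm D}$. The ground-state energy is $\lambda_1(\mathcal G;\mathsf V_{\mathrm D})=\min_{0\ne f\in H^1_0(\mathcal G;\mathsf V_{\mathrm D})}\|f'\|_{L^2}^2/\|f\|_{L^2}^2$. The torsion function $v$ with respect to $\mathsf V_{\mathrm D}$ is the unique function in $H^1_0(\mathcal G;\mathsf V_{\mathrm D})$, edgewise $H^2$, with $-v_{\mathsf e}''=1$ on each edge and sum of normal derivatives over all incident edges equal to $0$ at each vertex of $\mathsf V\setminus\mathsf V_{\mathrm D}$. The torsional rigidity is $T(\mathcal G;\mathsf V_{\mathrm D})=\int_{\mathcal G}v\,dx$. *)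

theory Defs
  imports "HOL-Analysis.Analysis"
begin

text \<open>Edge \<open>e\<close> is a copy of \<open>[0, len G e]\<close>, running from the vertex \<open>tail G e\<close> to the vertex
  \<open>head G e\<close>. Loops and parallel edges are allowed. The vertices are exactly the endpoints
  of the edges.\<close>

record ('v, 'e) metric_graph =
  edges :: "'e set"
  tail :: "'e \<Rightarrow> 'v"
  head :: "'e \<Rightarrow> 'v"
  len :: "'e \<Rightarrow> real"

definition vertices :: "('v, 'e) metric_graph \<Rightarrow> 'v set" where
  "vertices G = tail G ` edges G \<union> head G ` edges G"

datatype ('v, 'e) point = Vertex 'v | Inner 'e real

definition points :: "('v, 'e) metric_graph \<Rightarrow> ('v, 'e) point set" where
  "points G = Vertex ` vertices G \<union> {Inner e x | e x. e \<in> edges G \<and> 0 < x \<and> x < len G e}"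

text \<open>The point of the graph at coordinate \<open>x\<close> of edge \<open>e\<close>; for a function \<open>f\<close> on the graph,
  \<open>\<lambda>x. f (edge_pt G e x)\<close> on \<open>{0..len G e}\<close> is the edge component of \<open>f\<close> at \<open>e\<close>. Gluing is built in:
  endpoints of edges that meet at a vertex have the same image.\<close>

definition edge_pt :: "('v, 'e) metric_graph \<Rightarrow> 'e \<Rightarrow> real \<Rightarrow> ('v, 'e) point" where
  "edge_pt G e x =
     (if x = 0 then Vertex (tail G e) else if x = len G e then Vertex (head G e) else Inner e x)"

text \<open>The quotient topology of the disjoint union of the intervals \<open>[0, len G e]\<close>.\<close>

definition graph_topology :: "('v, 'e) metric_graph \<Rightarrow> ('v, 'e) point topology" where
  "graph_topology G = topology (\<lambda>U. U \<subseteq> points G \<and>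
     (\<forall>e\<in>edges G. openin (top_of_set {0..len G e}) {x \<in> {0..len G e}. edge_pt G e x \<in> U}))"

lemma openin_graph_topology:
  "openin (graph_topology G) U \<longleftrightarrow> U \<subseteq> points G \<and>
     (\<forall>e\<in>edges G. openin (top_of_set {0..len G e}) {x \<in> {0..len G e}. edge_pt G e x \<in> U})"
proof -
  let ?P = "\<lambda>U. U \<subseteq> points G \<and>
     (\<forall>e\<in>edges G. openin (top_of_set {0..len G e}) {x \<in> {0..len G e}. edge_pt G e x \<in> U})"
  have "istopology ?P"
    unfolding istopology_def
  proof (intro conjI allI impI)
    fix S T assume ST: "?P S" "?P T"
    have "{x \<in> {0..len G e}. edge_pt G e x \<in> S \<inter> T} =
        {x \<in> {0..len G e}. edge_pt G e x \<in> S} \<inter> {x \<in> {0..len G e}. edge_pt G e x \<in> T}" for e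
      by blast
    then show "\<forall>e\<in>edges G. openin (top_of_set {0..len G e}) {x \<in> {0..len G e}. edge_pt G e x \<in> S \<inter> T}"
      using ST by (auto intro!: openin_Int)
    show "S \<inter> T \<subseteq> points G" using ST by blast
  next
    fix K assume K: "\<forall>S\<in>K. ?P S"
    have "{x \<in> {0..len G e}. edge_pt G e x \<in> \<Union>K} =
        (\<Union>S\<in>K. {x \<in> {0..len G e}. edge_pt G e x \<in> S})" for e
      by blast
    then show "\<forall>e\<in>edges G. openin (top_of_set {0..len G e}) {x \<in> {0..len G e}. edge_pt G e x \<in> \<Union>K}"
      using K by (auto intro!: openin_Union)
    show "\<Union>K \<subseteq> points G" using K by blast
  qed
  then show ?thesis
    unfolding graph_topology_def by (simp add: topology_inverse')
qed

definition compact_connected_metric_graph :: "('v, 'e) metric_graph \<Rightarrow> bool" where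
  "compact_connected_metric_graph G \<longleftrightarrow>
     finite (edges G) \<and> (\<forall>e\<in>edges G. 0 < len G e) \<and> connected_space (graph_topology G)"

definition total_length :: "('v, 'e) metric_graph \<Rightarrow> real" where
  "total_length G = (\<Sum>e\<in>edges G. len G e)"

definition graph_integral :: "('v, 'e) metric_graph \<Rightarrow> (('v, 'e) point \<Rightarrow> real) \<Rightarrow> real" where
  "graph_integral G f =
     (\<Sum>e\<in>edges G. integral\<^sup>L (lebesgue_on {0..len G e}) (\<lambda>x. f (edge_pt G e x)))"

definition L2 :: "real \<Rightarrow> (real \<Rightarrow> real) set" where
  "L2 l = {f \<in> borel_measurable (lebesgue_on {0..l}). integrable (lebesgue_on {0..l}) (\<lambda>x. (f x)\<^sup>2)}"

definition test_function :: "real \<Rightarrow> (real \<Rightarrow> real) \<Rightarrow> bool" where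
  "test_function l \<phi> \<longleftrightarrow> \<phi> C1_differentiable_on UNIV \<and> closure {x. \<phi> x \<noteq> 0} \<subseteq> {0<..<l}"

text \<open>\<open>g\<close> is a representative of the weak derivative of \<open>f\<close> on the interval \<open>(0, l)\<close>, with test
  functions of class \<open>C\<^sup>1\<close> with compact support. It is unique only up to null sets.\<close>

definition has_weak_deriv :: "real \<Rightarrow> (real \<Rightarrow> real) \<Rightarrow> (real \<Rightarrow> real) \<Rightarrow> bool" where
  "has_weak_deriv l f g \<longleftrightarrow> (\<forall>\<phi>. test_function l \<phi> \<longrightarrow>
     integral\<^sup>L (lebesgue_on {0..l}) (\<lambda>x. f x * deriv \<phi> x) =
     - integral\<^sup>L (lebesgue_on {0..l}) (\<lambda>x. g x * \<phi> x))"

definition H1 :: "real \<Rightarrow> (real \<Rightarrow> real) set" where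
  "H1 l = {f \<in> L2 l. \<exists>g\<in>L2 l. has_weak_deriv l f g}"

text \<open>Extensionality makes functions on the graph that agree at all its points equal, so that
  uniqueness statements about them are meaningful.\<close>

definition H10 :: "('v, 'e) metric_graph \<Rightarrow> 'v set \<Rightarrow> (('v, 'e) point \<Rightarrow> real) set" where
  "H10 G VD = {f \<in> extensional (points G).
     continuous_map (graph_topology G) euclideanreal f \<and>
     (\<forall>e\<in>edges G. (\<lambda>x. f (edge_pt G e x)) \<in> H1 (len G e)) \<and>
     (\<forall>v\<in>VD. f (Vertex v) = 0)}"

text \<open>The minimum of the Rayleigh quotients, written as an infimum; \<open>g e\<close> is the weak derivative
  of \<open>f\<close> on edge \<open>e\<close>.\<close>

definition lambda1 :: "('v, 'e) metric_graph \<Rightarrow> 'v set \<Rightarrow> real" where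
  "lambda1 G VD = Inf
     {(\<Sum>e\<in>edges G. integral\<^sup>L (lebesgue_on {0..len G e}) (\<lambda>x. (g e x)\<^sup>2))
        / graph_integral G (\<lambda>p. (f p)\<^sup>2) | f g.
      f \<in> H10 G VD \<and> (\<exists>p\<in>points G. f p \<noteq> 0) \<and>
      (\<forall>e\<in>edges G. g e \<in> L2 (len G e) \<and>
         has_weak_deriv (len G e) (\<lambda>x. f (edge_pt G e x)) (g e))}"

text \<open>The sum over all edge ends at \<open>v\<close> of the derivatives pointing into the edges, so that a
  loop at \<open>v\<close> contributes both of its ends.\<close>

definition normal_derivative_sum ::
  "('v, 'e) metric_graph \<Rightarrow> (('v, 'e) point \<Rightarrow> real) \<Rightarrow> 'v \<Rightarrow> real" where
  "normal_derivative_sum G f v =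
     (\<Sum>e\<in>{e \<in> edges G. tail G e = v}.
        vector_derivative (\<lambda>x. f (edge_pt G e x)) (at 0 within {0..len G e})) -
     (\<Sum>e\<in>{e \<in> edges G. head G e = v}.
        vector_derivative (\<lambda>x. f (edge_pt G e x)) (at (len G e) within {0..len G e}))"

text \<open>The second condition says that every edge component is in \<open>H\<^sup>2\<close> with second weak
  derivative \<open>-1\<close>. Such a component is continuously differentiable up to the endpoints, so the
  derivatives in the last condition exist.\<close>

definition is_torsion_function ::
  "('v, 'e) metric_graph \<Rightarrow> 'v set \<Rightarrow> (('v, 'e) point \<Rightarrow> real) \<Rightarrow> bool" where
  "is_torsion_function G VD v \<longleftrightarrow>
     v \<in> H10 G VD \<and>
     (\<forall>e\<in>edges G. \<exists>g\<in>H1 (len G e).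
        has_weak_deriv (len G e) (\<lambda>x. v (edge_pt G e x)) g \<and>
        has_weak_deriv (len G e) g (\<lambda>x. - 1)) \<and>
     (\<forall>w\<in>vertices G - VD. normal_derivative_sum G v w = 0)"

definition torsion_function ::
  "('v, 'e) metric_graph \<Rightarrow> 'v set \<Rightarrow> ('v, 'e) point \<Rightarrow> real" where
  "torsion_function G VD = (THE v. is_torsion_function G VD v)"

definition torsional_rigidity :: "('v, 'e) metric_graph \<Rightarrow> 'v set \<Rightarrow> real" where
  "torsional_rigidity G VD = graph_integral G (torsion_function G VD)"

end

theory Submission
  imports Defs
begin

text \<open>The obstacle is that \<open>torsion_function\<close> is a definite description over
  functions whose derivatives are only weak, so nothing can be computed before all non-classical
  candidates are excluded. This is done by duality: adding x^2/2 to an edge component gives a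
  continuous function orthogonal to every second derivative of a compactly supported function, and
  such a function is affine. The energy identity comes from integrating (v v')' = (v')^2 - v over
  each edge; the endpoint terms, regrouped by vertices, vanish by the Dirichlet condition on
  \<open>VD\<close> and by the Kirchhoff condition elsewhere. Definiteness of the vertex system
  combines connectedness with \<open>VD\<close> being nonempty.\<close>

text \<open>Testing the Rayleigh quotient with the torsion function \<open>v\<close> and using
  \<open>\<integral>(v')\<^sup>2 = \<integral>v = T\<close> gives \<open>\<lambda>\<^sub>1 T \<le> (\<integral>v)\<^sup>2 / \<integral>v\<^sup>2\<close>. By the Cauchy-Schwarz inequality the right-hand side
  is less than the total length, because \<open>v\<close> is not constant. The existence and uniqueness of \<open>v\<close>
  reduce to its vertex values: on every edge \<open>v\<close> is the quadratic polynomial with second derivative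
  \<open>-1\<close> that interpolates them, and the conditions at the vertices form a positive definite linear
  system for the weighted graph Laplacian.\<close>

subsection \<open>Weak derivatives on an interval\<close>

lemma lebesgue_on_FTC:
  fixes F f :: "real \<Rightarrow> real"
  assumes "a \<le> b" and "continuous_on {a..b} f"
    and "\<And>x. x \<in> {a..b} \<Longrightarrow> (F has_real_derivative f x) (at x within {a..b})"
  shows "integral\<^sup>L (lebesgue_on {a..b}) f = F b - F a"
proof -
  have "(f has_integral F b - F a) {a..b}"
    by (rule fundamental_theorem_of_calculus)
      (use assms in \<open>auto simp: has_real_derivative_iff_has_vector_derivative\<close>)
  then show ?thesis
    using assms(2)
    by (simp add: lebesgue_integral_eq_integral continuous_imp_integrable_real integral_unique)
qed

lemma test_functionI:
  fixes \<phi> \<phi>' :: "real \<Rightarrow> real"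
  assumes "\<And>x. (\<phi> has_real_derivative \<phi>' x) (at x)" and "continuous_on UNIV \<phi>'"
    and "0 < a" "b < l" and "\<And>x. x \<notin> {a<..<b} \<Longrightarrow> \<phi> x = 0"
  shows "test_function l \<phi>"
proof -
  have "\<phi> C1_differentiable_on UNIV"
    unfolding C1_differentiable_on_def
    using assms(1,2) by (auto simp: has_real_derivative_iff_has_vector_derivative)
  moreover have "closure {x. \<phi> x \<noteq> 0} \<subseteq> {a..b}"
  proof (rule closure_minimal)
    have "{x. \<phi> x \<noteq> 0} \<subseteq> {a<..<b}"
      using assms(5) by blast
    then show "{x. \<phi> x \<noteq> 0} \<subseteq> {a..b}"
      by force
  qed simp
  ultimately show ?thesis
    using assms(3,4) unfolding test_function_def by force
qed

lemma test_functionE: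
  assumes "test_function l \<phi>"
  shows "(\<phi> has_real_derivative deriv \<phi> x) (at x)" and "continuous_on UNIV (deriv \<phi>)"
    and "\<phi> 0 = 0" and "\<phi> l = 0"
proof -
  obtain D where D: "\<And>x. (\<phi> has_real_derivative D x) (at x)" "continuous_on UNIV D"
    using assms
    by (auto simp: test_function_def C1_differentiable_on_def
        has_real_derivative_iff_has_vector_derivative)
  have "deriv \<phi> = D"
    using DERIV_imp_deriv[OF D(1)] by (rule ext)
  with D show "(\<phi> has_real_derivative deriv \<phi> x) (at x)" "continuous_on UNIV (deriv \<phi>)"
    by auto
  have "closure {x. \<phi> x \<noteq> 0} \<subseteq> {0<..<l}"
    using assms by (simp add: test_function_def)
  then have "{x. \<phi> x \<noteq> 0} \<subseteq> {0<..<l}"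
    by (rule order_trans[OF closure_subset])
  then have "\<not> \<phi> 0 \<noteq> 0" and "\<not> \<phi> l \<noteq> 0"
    by force+
  then show "\<phi> 0 = 0" and "\<phi> l = 0"
    by simp_all
qed

text \<open>Integration by parts: the boundary terms vanish because a test function is zero at both
  ends. One-sided derivatives at the ends suffice, which suits edge components.\<close>

lemma has_weak_deriv_classical:
  assumes "0 \<le> l" and "continuous_on {0..l} g"
    and "\<And>x. x \<in> {0..l} \<Longrightarrow> (f has_real_derivative g x) (at x within {0..l})"
  shows "has_weak_deriv l f g"
  unfolding has_weak_deriv_def
proof (intro allI impI)
  fix \<phi> assume t: "test_function l \<phi>"
  have cd: "continuous_on {0..l} (deriv \<phi>)"
    by (rule continuous_on_subset[OF test_functionE(2)[OF t] subset_UNIV])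
  have cp: "continuous_on {0..l} \<phi>"
    by (rule DERIV_continuous_on[OF has_field_derivative_at_within[OF test_functionE(1)[OF t]]])
  have cf: "continuous_on {0..l} f"
    using assms(3) by (rule DERIV_continuous_on)
  have "integral\<^sup>L (lebesgue_on {0..l}) (\<lambda>x. f x * deriv \<phi> x + g x * \<phi> x)
      = f l * \<phi> l - f 0 * \<phi> 0"
  proof (rule lebesgue_on_FTC)
    fix x assume x: "x \<in> {0..l}"
    show "((\<lambda>x. f x * \<phi> x) has_real_derivative f x * deriv \<phi> x + g x * \<phi> x) (at x within {0..l})"
      using DERIV_mult[OF assms(3)[OF x] has_field_derivative_at_within[OF test_functionE(1)[OF t]]]
      by (simp add: algebra_simps)
  qed (use assms cd cp cf in \<open>auto intro!: continuous_intros\<close>)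
  also have "integral\<^sup>L (lebesgue_on {0..l}) (\<lambda>x. f x * deriv \<phi> x + g x * \<phi> x) =
      integral\<^sup>L (lebesgue_on {0..l}) (\<lambda>x. f x * deriv \<phi> x) +
      integral\<^sup>L (lebesgue_on {0..l}) (\<lambda>x. g x * \<phi> x)"
    by (intro Bochner_Integration.integral_add continuous_imp_integrable_real continuous_intros
        assms cd cp cf)
  finally show "integral\<^sup>L (lebesgue_on {0..l}) (\<lambda>x. f x * deriv \<phi> x) =
      - integral\<^sup>L (lebesgue_on {0..l}) (\<lambda>x. g x * \<phi> x)"
    using test_functionE(3,4)[OF t] by simp
qed

text \<open>An antiderivative on the whole line is constant on each side of (a, b). Zero mean makes
  the two constants equal, so subtracting that value restores the support.\<close>

lemma antiderivative_supported:
  fixes \<psi> :: "real \<Rightarrow> real"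
  assumes "continuous_on UNIV \<psi>" and "0 < a" "a < b" "b < l"
    and "\<And>x. x \<notin> {a<..<b} \<Longrightarrow> \<psi> x = 0"
    and "integral\<^sup>L (lebesgue_on {0..l}) \<psi> = 0"
  shows "\<exists>\<phi>. (\<forall>x. (\<phi> has_real_derivative \<psi> x) (at x)) \<and> (\<forall>x. x \<notin> {a<..<b} \<longrightarrow> \<phi> x = 0)"
proof -
  have "\<exists>F. \<forall>x. - \<infinity> < ereal x \<longrightarrow> ereal x < \<infinity> \<longrightarrow> (F has_vector_derivative \<psi> x) (at x)"
    by (rule einterval_antiderivative) (use assms(1) in \<open>auto simp: continuous_on_eq_continuous_at\<close>)
  then obtain F where F: "\<And>x. (F has_real_derivative \<psi> x) (at x)"
    by (auto simp: has_real_derivative_iff_has_vector_derivative)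
  have "integral\<^sup>L (lebesgue_on {0..l}) \<psi> = F l - F 0"
    by (rule lebesgue_on_FTC[OF _ continuous_on_subset[OF assms(1) subset_UNIV]
          has_field_derivative_at_within[OF F]]) (use assms in simp)
  with assms(6) have Fl: "F l = F 0"
    by simp
  have "\<exists>c. \<forall>x\<in>{..a}. F x = c"
  proof (rule has_field_derivative_zero_constant)
    fix x assume "x \<in> {..a}"
    then have "\<psi> x = 0"
      using assms(5) by auto
    then show "(F has_real_derivative 0) (at x within {..a})"
      using has_field_derivative_at_within[OF F, of x] by simp
  qed auto
  then obtain c1 where c1: "F x = c1" if "x \<le> a" for x
    by auto
  have "\<exists>c. \<forall>x\<in>{b..}. F x = c"
  proof (rule has_field_derivative_zero_constant)
    fix x assume "x \<in> {b..}"
    then have "\<psi> x = 0"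
      using assms(5) by auto
    then show "(F has_real_derivative 0) (at x within {b..})"
      using has_field_derivative_at_within[OF F, of x] by simp
  qed auto
  then obtain c2 where c2: "F x = c2" if "b \<le> x" for x
    by auto
  have const: "F x = F 0" if "x \<notin> {a<..<b}" for x
  proof (cases "x \<le> a")
    case True
    then show ?thesis
      using c1[of x] c1[of 0] assms(2) by simp
  next
    case False
    then show ?thesis
      using that c2[of x] c2[of l] assms(4) Fl by simp
  qed
  have "((\<lambda>x. F x - F 0) has_real_derivative \<psi> x) (at x)" for x
    by (rule derivative_eq_intros F refl)+ simp
  with const show ?thesis
    by (intro exI[of _ "\<lambda>x. F x - F 0"]) auto
qed

text \<open>Zero mean yields a supported first antiderivative; the vanishing first moment is what
  gives it zero mean in turn, so the previous construction can be repeated.\<close>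

lemma second_antiderivative_supported:
  fixes \<psi> :: "real \<Rightarrow> real"
  assumes "continuous_on UNIV \<psi>" and "0 < a" "a < b" "b < l"
    and "\<And>x. x \<notin> {a<..<b} \<Longrightarrow> \<psi> x = 0"
    and "integral\<^sup>L (lebesgue_on {0..l}) \<psi> = 0"
    and "integral\<^sup>L (lebesgue_on {0..l}) (\<lambda>x. x * \<psi> x) = 0"
  obtains \<phi> \<phi>' where "\<And>x. (\<phi>' has_real_derivative \<psi> x) (at x)"
    and "\<And>x. (\<phi> has_real_derivative \<phi>' x) (at x)"
    and "\<And>x. x \<notin> {a<..<b} \<Longrightarrow> \<phi>' x = 0" and "\<And>x. x \<notin> {a<..<b} \<Longrightarrow> \<phi> x = 0"
proof -
  obtain \<phi>' where \<phi>': "\<And>x. (\<phi>' has_real_derivative \<psi> x) (at x)"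
    "\<And>x. x \<notin> {a<..<b} \<Longrightarrow> \<phi>' x = 0"
    using antiderivative_supported[OF assms(1-6)] by auto
  have c: "continuous_on S \<phi>'" "continuous_on S \<psi>" for S
    by (rule DERIV_continuous_on[OF has_field_derivative_at_within[OF \<phi>'(1)]])
      (rule continuous_on_subset[OF assms(1) subset_UNIV])
  \<comment> \<open>The derivative of x \<phi>'(x) trades the mean of \<phi>' for the first moment
    of \<psi>.\<close>
  have "integral\<^sup>L (lebesgue_on {0..l}) (\<lambda>x. \<phi>' x + x * \<psi> x) = l * \<phi>' l - 0 * \<phi>' 0"
  proof (rule lebesgue_on_FTC)
    fix x
    show "((\<lambda>x. x * \<phi>' x) has_real_derivative \<phi>' x + x * \<psi> x) (at x within {0..l})"
      by (rule derivative_eq_intros has_field_derivative_at_within[OF \<phi>'(1)] refl)+ simp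
  qed (use assms c in \<open>auto intro!: continuous_intros\<close>)
  also have "integral\<^sup>L (lebesgue_on {0..l}) (\<lambda>x. \<phi>' x + x * \<psi> x) =
     integral\<^sup>L (lebesgue_on {0..l}) \<phi>' + integral\<^sup>L (lebesgue_on {0..l}) (\<lambda>x. x * \<psi> x)"
    by (intro Bochner_Integration.integral_add continuous_imp_integrable_real continuous_intros c)
  finally have "integral\<^sup>L (lebesgue_on {0..l}) \<phi>' = 0"
    using \<phi>'(2) assms by simp
  then obtain \<phi> where \<phi>: "\<And>x. (\<phi> has_real_derivative \<phi>' x) (at x)"
    "\<And>x. x \<notin> {a<..<b} \<Longrightarrow> \<phi> x = 0"
    using antiderivative_supported[OF c(1) assms(2-4) \<phi>'(2)] by auto
  from \<phi>'(1) \<phi>(1) \<phi>'(2) \<phi>(2) show ?thesis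
    by (rule that)
qed

text \<open>The test function is \<open>\<psi> = \<eta> (w - A)\<close>, where \<open>\<eta>\<close> is a cut-off function and \<open>A\<close> is the
  orthogonal projection of \<open>w\<close> to the affine functions in \<open>L\<^sup>2(\<eta> dx)\<close>: annihilating it gives
  \<open>\<integral>\<eta> (w - A)\<^sup>2 = 0\<close>.\<close>

lemma affine_if_annihilates:
  fixes w :: "real \<Rightarrow> real"
  assumes w: "continuous_on {0..l} w" and ab: "0 < a" "a < b" "b < l"
    and ann: "\<And>\<psi>. continuous_on UNIV \<psi> \<Longrightarrow> (\<And>x. x \<notin> {a<..<b} \<Longrightarrow> \<psi> x = 0) \<Longrightarrow>
      integral\<^sup>L (lebesgue_on {0..l}) \<psi> = 0 \<Longrightarrow>
      integral\<^sup>L (lebesgue_on {0..l}) (\<lambda>x. x * \<psi> x) = 0 \<Longrightarrow>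
      integral\<^sup>L (lebesgue_on {0..l}) (\<lambda>x. w x * \<psi> x) = 0"
  shows "\<exists>\<alpha> \<beta>. \<forall>x\<in>{a<..<b}. w x = \<alpha> + \<beta> * x"
proof -
  define I where "I f = integral\<^sup>L (lebesgue_on {0..l}) f" for f :: "real \<Rightarrow> real"
  have I_diff: "I (\<lambda>x. f x - g x) = I f - I g" if "continuous_on {0..l} f" "continuous_on {0..l} g" for f g
    unfolding I_def by (intro Bochner_Integration.integral_diff continuous_imp_integrable_real that)
  have I_cmult: "I (\<lambda>x. c * f x) = c * I f" for c f
    unfolding I_def by simp
  have I_lin: "I (\<lambda>x. f x - c * g x - d * h x) = I f - c * I g - d * I h"
    if "continuous_on {0..l} f" "continuous_on {0..l} g" "continuous_on {0..l} h" for f g h c d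
  proof -
    have "I (\<lambda>x. f x - c * g x - d * h x) = I (\<lambda>x. f x - c * g x) - I (\<lambda>x. d * h x)"
      by (intro I_diff continuous_intros that)
    also have "I (\<lambda>x. f x - c * g x) = I f - I (\<lambda>x. c * g x)"
      by (intro I_diff continuous_intros that)
    finally show ?thesis
      by (simp only: I_cmult)
  qed
  have I_cong: "I f = I g" if "\<And>x. x \<in> {0..l} \<Longrightarrow> f x = g x" for f g
    unfolding I_def using that by (intro Bochner_Integration.integral_cong) auto
  have I_zero: "f x = 0" if "I f = 0" "continuous_on {0..l} f" "\<And>x. x \<in> {0..l} \<Longrightarrow> f x \<ge> 0"
    "x \<in> {0..l}" for f x
    using integralL_eq_0_iff[OF that(2)] that ab unfolding I_def by force
  \<comment> \<open>A parabola truncated at zero: continuous on the line and positive exactly on (a,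
    b).\<close>
  define \<eta> where "\<eta> x = max 0 ((x - a) * (b - x))" for x :: real
  have \<eta>c: "continuous_on S \<eta>" for S
    unfolding \<eta>_def by (intro continuous_intros)
  have \<eta>0: "\<eta> x \<ge> 0" for x
    unfolding \<eta>_def by simp
  have \<eta>pos: "\<eta> x > 0" if "x \<in> {a<..<b}" for x
    using that unfolding \<eta>_def by auto
  have \<eta>out: "\<eta> x = 0" if "x \<notin> {a<..<b}" for x
    using that ab unfolding \<eta>_def by (auto simp: max_def mult_le_0_iff not_less zero_le_mult_iff)
  \<comment> \<open>The \<eta>-weighted mean of x: it makes 1 and x - m orthogonal, so the
    projection coefficients \<open>A\<close> and \<open>B\<close> below can be computed
    separately.\<close>
  define m where "m = I (\<lambda>x. x * \<eta> x) / I \<eta>"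
  \<comment> \<open>With two points of positive weight, at least one differs from m; this keeps the
    denominator of \<open>B\<close> nonzero.\<close>
  obtain y z where yz: "y \<in> {a<..<b}" "z \<in> {a<..<b}" "y \<noteq> z"
    by (rule that[of "(2 * a + b) / 3" "(a + 2 * b) / 3"]) (use ab in auto)
  have I\<eta>: "I \<eta> \<noteq> 0"
    using I_zero[of \<eta> y] \<eta>c \<eta>0 \<eta>pos yz ab by force
  have I2: "I (\<lambda>x. (x - m)\<^sup>2 * \<eta> x) \<noteq> 0"
  proof
    assume 0: "I (\<lambda>x. (x - m)\<^sup>2 * \<eta> x) = 0"
    have "(x - m)\<^sup>2 * \<eta> x = 0" if "x \<in> {0..l}" for x
      by (rule I_zero[OF 0 _ _ that]) (use \<eta>0 in \<open>auto intro!: continuous_intros \<eta>c\<close>)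
    from this[of y] this[of z] show False
      using \<eta>pos yz ab by force
  qed
  have I1: "I (\<lambda>x. (x - m) * \<eta> x) = 0"
  proof -
    have "I (\<lambda>x. (x - m) * \<eta> x) = I (\<lambda>x. x * \<eta> x) - I (\<lambda>x. m * \<eta> x)"
      by (subst I_diff[symmetric]) (auto intro!: continuous_intros \<eta>c I_cong simp: algebra_simps)
    also have "\<dots> = I (\<lambda>x. x * \<eta> x) - m * I \<eta>"
      by (simp only: I_cmult)
    finally show ?thesis
      using I\<eta> by (simp add: m_def)
  qed
  define A where "A = I (\<lambda>x. w x * \<eta> x) / I \<eta>"
  define B where "B = I (\<lambda>x. w x * ((x - m) * \<eta> x)) / I (\<lambda>x. (x - m)\<^sup>2 * \<eta> x)"
  define p where "p x = w x - A - B * (x - m)" for x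
  have pc: "continuous_on {0..l} p"
    unfolding p_def by (intro continuous_intros w)
  have p0: "I (\<lambda>x. \<eta> x * p x) = 0"
  proof -
    have "I (\<lambda>x. \<eta> x * p x) = I (\<lambda>x. w x * \<eta> x - A * \<eta> x - B * ((x - m) * \<eta> x))"
      by (auto intro!: I_cong simp: p_def algebra_simps)
    also have "\<dots> = I (\<lambda>x. w x * \<eta> x) - A * I \<eta> - B * I (\<lambda>x. (x - m) * \<eta> x)"
      by (intro I_lin continuous_intros \<eta>c w)
    finally show ?thesis
      using I\<eta> I1 by (simp add: A_def)
  qed
  have p1: "I (\<lambda>x. (x - m) * (\<eta> x * p x)) = 0"
  proof -
    have "I (\<lambda>x. (x - m) * (\<eta> x * p x)) =
        I (\<lambda>x. w x * ((x - m) * \<eta> x) - A * ((x - m) * \<eta> x) - B * ((x - m)\<^sup>2 * \<eta> x))"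
      by (auto intro!: I_cong simp: p_def algebra_simps power2_eq_square)
    also have "\<dots> = I (\<lambda>x. w x * ((x - m) * \<eta> x)) - A * I (\<lambda>x. (x - m) * \<eta> x)
        - B * I (\<lambda>x. (x - m)\<^sup>2 * \<eta> x)"
      by (intro I_lin continuous_intros \<eta>c w)
    finally show ?thesis
      using I2 I1 by (simp add: B_def)
  qed
  \<comment> \<open>The annihilation hypothesis speaks of the moment against x, not x - m. The zero
    third term only fits the shape of \<open>I_lin\<close>.\<close>
  have px: "I (\<lambda>x. x * (\<eta> x * p x)) = 0"
  proof -
    have "I (\<lambda>x. x * (\<eta> x * p x)) =
        I (\<lambda>x. (x - m) * (\<eta> x * p x) - (- m) * (\<eta> x * p x) - 0 * (\<eta> x * p x))"
      by (auto intro!: I_cong simp: algebra_simps)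
    also have "\<dots> = I (\<lambda>x. (x - m) * (\<eta> x * p x)) - (- m) * I (\<lambda>x. \<eta> x * p x)
        - 0 * I (\<lambda>x. \<eta> x * p x)"
      by (intro I_lin continuous_intros \<eta>c pc)
    finally show ?thesis
      using p0 p1 by simp
  qed
  \<comment> \<open>\<open>w\<close> is controlled on [0, l] only; clamping the argument extends the
    residual continuously to the line, without changing it on the interval.\<close>
  define \<psi> where "\<psi> x = \<eta> x * p (max 0 (min l x))" for x
  have \<psi>eq: "\<psi> x = \<eta> x * p x" if "x \<in> {0..l}" for x
  proof -
    have "max 0 (min l x) = x"
      using that by auto
    then show ?thesis
      by (simp add: \<psi>_def)
  qed
  have "continuous_on UNIV (\<lambda>x. p (max 0 (min l x)))"
    by (rule continuous_on_compose2[OF pc]) (use ab in \<open>auto intro!: continuous_intros\<close>)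
  then have \<psi>c: "continuous_on UNIV \<psi>"
    unfolding \<psi>_def by (intro continuous_intros \<eta>c)
  have w\<psi>: "I (\<lambda>x. w x * \<psi> x) = 0"
    unfolding I_def
  proof (rule ann[OF \<psi>c])
    show "\<psi> x = 0" if "x \<notin> {a<..<b}" for x
      using \<eta>out[OF that] by (simp add: \<psi>_def)
    have "I \<psi> = 0"
      using I_cong[OF \<psi>eq] p0 by simp
    then show "integral\<^sup>L (lebesgue_on {0..l}) \<psi> = 0"
      by (simp add: I_def)
    have "I (\<lambda>x. x * \<psi> x) = I (\<lambda>x. x * (\<eta> x * p x))"
      by (rule I_cong) (simp add: \<psi>eq)
    then show "integral\<^sup>L (lebesgue_on {0..l}) (\<lambda>x. x * \<psi> x) = 0"
      using px by (simp add: I_def)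
  qed
  \<comment> \<open>One factor \<open>p\<close> is expanded: its \<open>w\<close> part is
    annihilated, and its affine part is orthogonal to the residual.\<close>
  have "I (\<lambda>x. \<eta> x * (p x)\<^sup>2) =
      I (\<lambda>x. w x * \<psi> x - A * (\<eta> x * p x) - B * ((x - m) * (\<eta> x * p x)))"
    by (rule I_cong) (simp add: \<psi>eq p_def algebra_simps power2_eq_square)
  also have "\<dots> = I (\<lambda>x. w x * \<psi> x) - A * I (\<lambda>x. \<eta> x * p x) - B * I (\<lambda>x. (x - m) * (\<eta> x * p x))"
    by (intro I_lin continuous_intros \<eta>c w pc continuous_on_subset[OF \<psi>c subset_UNIV])
  finally have I0: "I (\<lambda>x. \<eta> x * (p x)\<^sup>2) = 0"
    using w\<psi> p0 p1 by simp
  have "w x = (A - B * m) + B * x" if x: "x \<in> {a<..<b}" for x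
  proof -
    have "\<eta> x * (p x)\<^sup>2 = 0"
      by (rule I_zero[OF I0]) (use \<eta>0 x ab in \<open>auto intro!: continuous_intros \<eta>c pc\<close>)
    then have "p x = 0"
      using \<eta>pos[OF x] by simp
    then show ?thesis
      by (simp add: p_def algebra_simps)
  qed
  then show ?thesis
    by blast
qed

text \<open>The solution of -q'' = 1 with boundary values s and t: the affine interpolant plus the
  torsion function of the interval with both ends Dirichlet.\<close>

definition quad_interp :: "real \<Rightarrow> real \<Rightarrow> real \<Rightarrow> real \<Rightarrow> real" where
  "quad_interp l s t x = s + (t - s) / l * x + x * (l - x) / 2"

text \<open>Adding x^2/2 cancels the second derivative, so \<open>w\<close> below is affine on every
  compactly contained interval. Continuity carries this to the endpoints and identifies the
  coefficients.\<close>

lemma weak_torsion_quadratic: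
  assumes l: "0 < l" and f: "continuous_on {0..l} f"
    and fg: "has_weak_deriv l f g" and g: "has_weak_deriv l g (\<lambda>x. - 1)"
    and y: "y \<in> {0..l}"
  shows "f y = quad_interp l (f 0) (f l) y"
proof -
  define w where "w x = f x + x\<^sup>2 / 2" for x
  have wc: "continuous_on {0..l} w"
    unfolding w_def by (intro continuous_intros f) auto
  have aff: "\<exists>\<alpha> \<beta>. \<forall>x\<in>{a<..<b}. w x = \<alpha> + \<beta> * x" if ab: "0 < a" "a < b" "b < l" for a b
  proof (rule affine_if_annihilates[OF wc ab])
    fix \<psi> :: "real \<Rightarrow> real"
    assume c: "continuous_on UNIV \<psi>" and out: "\<And>x. x \<notin> {a<..<b} \<Longrightarrow> \<psi> x = 0"
      and m0: "integral\<^sup>L (lebesgue_on {0..l}) \<psi> = 0"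
      and m1: "integral\<^sup>L (lebesgue_on {0..l}) (\<lambda>x. x * \<psi> x) = 0"
    show "integral\<^sup>L (lebesgue_on {0..l}) (\<lambda>x. w x * \<psi> x) = 0"
    proof (rule second_antiderivative_supported[OF c ab out m0 m1])
      fix \<phi> \<phi>'
      assume d': "\<And>x. (\<phi>' has_real_derivative \<psi> x) (at x)"
        and d: "\<And>x. (\<phi> has_real_derivative \<phi>' x) (at x)"
        and out': "\<And>x. x \<notin> {a<..<b} \<Longrightarrow> \<phi>' x = 0" "\<And>x. x \<notin> {a<..<b} \<Longrightarrow> \<phi> x = 0"
      have c': "continuous_on S \<phi>'" "continuous_on S \<phi>" "continuous_on S \<psi>" for S
        using DERIV_continuous_on[OF has_field_derivative_at_within[OF d']]
          DERIV_continuous_on[OF has_field_derivative_at_within[OF d]]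
          continuous_on_subset[OF c subset_UNIV] by simp_all
      \<comment> \<open>Both levels serve as test functions: \<open>\<phi>'\<close> for the weak
        derivative of \<open>f\<close>, \<open>\<phi>\<close> for that of \<open>g\<close>.\<close>
      have t: "test_function l \<phi>" "test_function l \<phi>'"
        by (rule test_functionI[OF d c'(1) ab(1,3) out'(2)] test_functionI[OF d' c ab(1,3) out'(1)];
            assumption)+
      have deriv: "deriv \<phi> = \<phi>'" "deriv \<phi>' = \<psi>"
        using d d' by (auto intro!: DERIV_imp_deriv)
      \<comment> \<open>Two integrations by parts at once: x^2/2 tested with \<psi> gives the
        integral of \<phi>, which will cancel the contribution of \<open>f\<close>.\<close>
      have "integral\<^sup>L (lebesgue_on {0..l}) (\<lambda>x. x\<^sup>2 / 2 * \<psi> x - \<phi> x) =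
          (l\<^sup>2 / 2 * \<phi>' l - l * \<phi> l) - (0\<^sup>2 / 2 * \<phi>' 0 - 0 * \<phi> 0)"
      proof (rule lebesgue_on_FTC)
        fix x
        show "((\<lambda>x. x\<^sup>2 / 2 * \<phi>' x - x * \<phi> x) has_real_derivative x\<^sup>2 / 2 * \<psi> x - \<phi> x) (at x within {0..l})"
          by (auto intro!: derivative_eq_intros has_field_derivative_at_within[OF d]
              has_field_derivative_at_within[OF d'] simp: field_simps)
      next
        show "continuous_on {0..l} (\<lambda>x. x\<^sup>2 / 2 * \<psi> x - \<phi> x)"
          by (intro continuous_intros c') auto
      qed (use l in simp)
      then have 1: "integral\<^sup>L (lebesgue_on {0..l}) (\<lambda>x. x\<^sup>2 / 2 * \<psi> x - \<phi> x) = 0"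
        using out' ab by simp
      have "integral\<^sup>L (lebesgue_on {0..l}) (\<lambda>x. f x * \<psi> x) = integral\<^sup>L (lebesgue_on {0..l}) (\<lambda>x. - \<phi> x)"
      proof -
        have "integral\<^sup>L (lebesgue_on {0..l}) (\<lambda>x. f x * deriv \<phi>' x) =
            - integral\<^sup>L (lebesgue_on {0..l}) (\<lambda>x. g x * \<phi>' x)"
          using fg t(2) unfolding has_weak_deriv_def by blast
        moreover have "integral\<^sup>L (lebesgue_on {0..l}) (\<lambda>x. g x * deriv \<phi> x) =
            - integral\<^sup>L (lebesgue_on {0..l}) (\<lambda>x. - 1 * \<phi> x)"
          using g t(1) unfolding has_weak_deriv_def by blast
        ultimately show ?thesis
          by (simp add: deriv)
      qed
      moreover have "integral\<^sup>L (lebesgue_on {0..l}) (\<lambda>x. w x * \<psi> x) =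
          integral\<^sup>L (lebesgue_on {0..l}) (\<lambda>x. (f x * \<psi> x + (x\<^sup>2 / 2 * \<psi> x - \<phi> x)) + \<phi> x)"
        by (rule Bochner_Integration.integral_cong) (auto simp: w_def algebra_simps)
      moreover have "\<dots> =
          integral\<^sup>L (lebesgue_on {0..l}) (\<lambda>x. f x * \<psi> x + (x\<^sup>2 / 2 * \<psi> x - \<phi> x)) +
          integral\<^sup>L (lebesgue_on {0..l}) \<phi>"
        by (intro Bochner_Integration.integral_add continuous_imp_integrable_real
            continuous_intros f c') auto
      moreover have "integral\<^sup>L (lebesgue_on {0..l}) (\<lambda>x. f x * \<psi> x + (x\<^sup>2 / 2 * \<psi> x - \<phi> x)) =
          integral\<^sup>L (lebesgue_on {0..l}) (\<lambda>x. f x * \<psi> x) +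
          integral\<^sup>L (lebesgue_on {0..l}) (\<lambda>x. x\<^sup>2 / 2 * \<psi> x - \<phi> x)"
        by (intro Bochner_Integration.integral_add continuous_imp_integrable_real
            continuous_intros f c') auto
      ultimately show "integral\<^sup>L (lebesgue_on {0..l}) (\<lambda>x. w x * \<psi> x) = 0"
        using 1 by simp
    qed
  qed
  have "l * w y = (l - y) * w 0 + y * w l"
  proof (cases "y = 0 \<or> y = l")
    case False
    with y have y: "0 < y" "y < l" by auto
    \<comment> \<open>Collinearity of the values at e < y < l - e, free of the coefficients \<alpha>
      and \<beta>, which may depend on e; it can therefore pass to the limit e -> 0.\<close>
    have eq: "(l - 2 * e) * w y - (l - e - y) * w e - (y - e) * w (l - e) = 0"
      if e: "0 < e" "e < min y (l - y)" for e
    proof -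
      obtain \<alpha> \<beta> where "\<forall>x\<in>{e/2<..<l-e/2}. w x = \<alpha> + \<beta> * x"
        using aff[of "e/2" "l-e/2"] e y by auto
      then have "w y = \<alpha> + \<beta> * y" "w e = \<alpha> + \<beta> * e" "w (l - e) = \<alpha> + \<beta> * (l - e)"
        using e by auto
      then show ?thesis
        by (simp only:) (simp add: algebra_simps)
    qed
    let ?F = "at (0::real) within {0..l}"
    have "(w \<longlongrightarrow> w 0) ?F"
      using wc l by (simp add: continuous_on_def)
    moreover have "((\<lambda>e. w (l - e)) \<longlongrightarrow> w (l - 0)) ?F"
    proof -
      have "continuous_on {0..l} (\<lambda>e. w (l - e))"
        by (rule continuous_on_compose2[OF wc]) (auto intro!: continuous_intros)
      then show ?thesis
        unfolding continuous_on_def by (rule bspec) (use l in simp)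
    qed
    ultimately have "((\<lambda>e. (l - 2 * e) * w y - (l - e - y) * w e - (y - e) * w (l - e)) \<longlongrightarrow>
        (l - 2 * 0) * w y - (l - 0 - y) * w 0 - (y - 0) * w (l - 0)) ?F"
      by (intro tendsto_intros)
    moreover have "((\<lambda>e. (l - 2 * e) * w y - (l - e - y) * w e - (y - e) * w (l - e)) \<longlongrightarrow> 0) ?F"
    proof (rule tendsto_eventually)
      show "\<forall>\<^sub>F e in ?F. (l - 2 * e) * w y - (l - e - y) * w e - (y - e) * w (l - e) = 0"
        unfolding eventually_at
        by (rule exI[of _ "min y (l - y)"]) (use y eq in \<open>auto simp: dist_real_def\<close>)
    qed
    moreover have "?F \<noteq> bot"
      using l by (simp add: trivial_limit_within islimpt_Icc)
    ultimately have "(l - 2 * 0) * w y - (l - 0 - y) * w 0 - (y - 0) * w (l - 0) = 0"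
      using tendsto_unique by blast
    then show ?thesis by simp
  qed auto
  then have "l * f y = (l - y) * f 0 + y * f l + l * (y * (l - y) / 2)"
    by (simp add: w_def field_simps power2_eq_square)
  then have "f y = ((l - y) * f 0 + y * f l + l * (y * (l - y) / 2)) / l"
    using l by (simp add: field_simps)
  then show ?thesis
    using l by (simp add: quad_interp_def field_simps)
qed

section \<open>Calculus of the interpolating parabola\<close>

lemma quad_interp_deriv:
  assumes "0 < l"
  shows "(quad_interp l s t has_real_derivative (t - s) / l + l / 2 - x) (at x within S)"
  unfolding quad_interp_def using assms
  by (auto intro!: derivative_eq_intros simp: field_simps)

lemma quad_interp_0 [simp]: "quad_interp l s t 0 = s"
  by (simp add: quad_interp_def)

lemma quad_interp_len [simp]: "0 < l \<Longrightarrow> quad_interp l s t l = t"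
  by (simp add: quad_interp_def)

lemma continuous_on_quad_interp: "0 < l \<Longrightarrow> continuous_on S (quad_interp l s t)"
  by (rule DERIV_continuous_on[OF quad_interp_deriv])

text \<open>The second difference over both ends and the midpoint removes the affine part and leaves
  \<open>- l\<^sup>2 / 4\<close>.\<close>

lemma quad_interp_not_constant:
  assumes "0 < l" and "\<forall>x\<in>{0..l}. quad_interp l s t x = c"
  shows False
proof -
  have "quad_interp l s t 0 = c" "quad_interp l s t l = c" "quad_interp l s t (l / 2) = c"
    by (rule assms(2)[rule_format], use assms(1) in simp)+
  then have "quad_interp l s t 0 + quad_interp l s t l - 2 * quad_interp l s t (l / 2) = 0"
    by simp
  then show False
    using assms(1) by (simp add: quad_interp_def field_simps)
qed

text \<open>From (q q')' = (q')^2 - q, since q'' = -1. The endpoint terms are kept because they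
  cancel only after summation over the edges at a vertex.\<close>

lemma integral_deriv_quad_interp_square:
  assumes l: "0 < l"
  shows "integral\<^sup>L (lebesgue_on {0..l}) (\<lambda>x. ((t - s) / l + l / 2 - x)\<^sup>2) =
    integral\<^sup>L (lebesgue_on {0..l}) (quad_interp l s t)
    + t * ((t - s) / l - l / 2) - s * ((t - s) / l + l / 2)"
proof -
  let ?d = "\<lambda>x. (t - s) / l + l / 2 - x"
  let ?q = "quad_interp l s t"
  have "integral\<^sup>L (lebesgue_on {0..l}) (\<lambda>x. (?d x)\<^sup>2 - ?q x) = ?q l * ?d l - ?q 0 * ?d 0"
  proof (rule lebesgue_on_FTC)
    show "continuous_on {0..l} (\<lambda>x. (?d x)\<^sup>2 - ?q x)"
      by (intro continuous_intros continuous_on_quad_interp l)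
    show "((\<lambda>x. ?q x * ?d x) has_real_derivative (?d x)\<^sup>2 - ?q x) (at x within {0..l})" for x
    proof -
      have "(?d has_real_derivative - 1) (at x within {0..l})"
        by (auto intro!: derivative_eq_intros)
      from DERIV_mult[OF quad_interp_deriv[OF l] this] show ?thesis
        by (simp add: power2_eq_square)
    qed
  qed (use l in simp)
  also have "integral\<^sup>L (lebesgue_on {0..l}) (\<lambda>x. (?d x)\<^sup>2 - ?q x) =
      integral\<^sup>L (lebesgue_on {0..l}) (\<lambda>x. (?d x)\<^sup>2) - integral\<^sup>L (lebesgue_on {0..l}) ?q"
    by (intro Bochner_Integration.integral_diff continuous_imp_integrable_real continuous_intros
        continuous_on_quad_interp l)
  finally show ?thesis
    using l by (simp add: algebra_simps)
qed

lemma continuous_on_imp_L2: "continuous_on {0..l} f \<Longrightarrow> f \<in> L2 l"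
  unfolding L2_def
  by (auto intro!: continuous_imp_integrable_real borel_measurable_integrable continuous_on_power)


subsection \<open>Functions on the graph\<close>

lemma edge_pt_in_points:
  assumes "e \<in> edges G" and "x \<in> {0..len G e}"
  shows "edge_pt G e x \<in> points G"
  using assms unfolding edge_pt_def points_def vertices_def by auto

lemma topspace_graph_topology [simp]: "topspace (graph_topology G) = points G"
proof (rule subset_antisym)
  show "topspace (graph_topology G) \<subseteq> points G"
    unfolding topspace_def by (auto simp: openin_graph_topology)
  have "{x \<in> {0..len G e}. edge_pt G e x \<in> points G} = {0..len G e}" if "e \<in> edges G" for e
    using edge_pt_in_points[OF that] by auto
  then have "openin (graph_topology G) (points G)"
    by (simp add: openin_graph_topology)
  then show "points G \<subseteq> topspace (graph_topology G)"
    by (rule openin_subset)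
qed

text \<open>The universal property of the quotient topology.\<close>

lemma continuous_map_graph_iff:
  "continuous_map (graph_topology G) euclideanreal f \<longleftrightarrow>
    (\<forall>e\<in>edges G. continuous_on {0..len G e} (\<lambda>x. f (edge_pt G e x)))"
proof -
  have "{x \<in> {0..len G e}. edge_pt G e x \<in> {p \<in> points G. f p \<in> U}} =
      {x \<in> {0..len G e}. f (edge_pt G e x) \<in> U}" if "e \<in> edges G" for e U
    using edge_pt_in_points[OF that] by auto
  then have "continuous_map (graph_topology G) euclideanreal f \<longleftrightarrow> (\<forall>e\<in>edges G.
      \<forall>U. open U \<longrightarrow> openin (top_of_set {0..len G e}) {x \<in> {0..len G e}. f (edge_pt G e x) \<in> U})"
    unfolding continuous_map_def by (auto simp: openin_graph_topology)
  also have "\<dots> \<longleftrightarrow> (\<forall>e\<in>edges G. continuous_on {0..len G e} (\<lambda>x. f (edge_pt G e x)))"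
    by (simp flip: continuous_map_iff_continuous add: continuous_map_def)
  finally show ?thesis .
qed

text \<open>Spreading \<open>u\<close> constantly along each edge gives a locally constant function:
  on an edge, every preimage is everything or nothing. Its level sets are clopen, so topological
  connectedness applies without any paths.\<close>

lemma constant_on_vertices:
  assumes "compact_connected_metric_graph G"
    and eq: "\<And>e. e \<in> edges G \<Longrightarrow> u (tail G e) = u (head G e)"
    and "a \<in> vertices G" and "b \<in> vertices G"
  shows "u a = u b"
proof -
  define val where "val p = (case p of Vertex v \<Rightarrow> u v | Inner e x \<Rightarrow> u (tail G e))" for p
  have val: "val (edge_pt G e x) = u (tail G e)" if "e \<in> edges G" for e x
    using eq[OF that] by (simp add: val_def edge_pt_def)
  have op: "openin (graph_topology G) {p \<in> points G. Q (val p)}" for Q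
    unfolding openin_graph_topology
  proof (intro conjI ballI)
    fix e assume e: "e \<in> edges G"
    have "{x \<in> {0..len G e}. edge_pt G e x \<in> {p \<in> points G. Q (val p)}} =
        (if Q (u (tail G e)) then {0..len G e} else {})"
      using edge_pt_in_points[OF e] val[OF e] by auto
    then show "openin (top_of_set {0..len G e})
        {x \<in> {0..len G e}. edge_pt G e x \<in> {p \<in> points G. Q (val p)}}"
      by simp
  qed auto
  let ?T = "{p \<in> points G. val p = u a}"
  have "points G - ?T = {p \<in> points G. val p \<noteq> u a}"
    by auto
  then have "closedin (graph_topology G) ?T"
    using op[of "\<lambda>y. y \<noteq> u a"] unfolding closedin_def by auto
  moreover have "openin (graph_topology G) ?T"
    by (rule op)
  moreover have "\<forall>T. openin (graph_topology G) T \<and> closedin (graph_topology G) T \<longrightarrow>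
      T = {} \<or> T = points G"
    using assms(1) unfolding compact_connected_metric_graph_def connected_space_clopen_in by simp
  ultimately have "?T = {} \<or> ?T = points G"
    by blast
  moreover have "Vertex a \<in> ?T"
    using assms(3) by (simp add: points_def val_def)
  moreover have "Vertex b \<in> points G"
    using assms(4) by (simp add: points_def)
  ultimately have "val (Vertex b) = u a"
    by blast
  then show ?thesis
    by (simp add: val_def)
qed

text \<open>The restriction to \<open>points G\<close> matches the extensionality in
  \<open>H10\<close>, so that vertex values determine the function completely.\<close>

definition quad_ext :: "('v, 'e) metric_graph \<Rightarrow> ('v \<Rightarrow> real) \<Rightarrow> ('v, 'e) point \<Rightarrow> real" where
  "quad_ext G u = (\<lambda>p\<in>points G. case p of Vertex v \<Rightarrow> u v
     | Inner e x \<Rightarrow> quad_interp (len G e) (u (tail G e)) (u (head G e)) x)"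

lemma quad_ext_Vertex: "v \<in> vertices G \<Longrightarrow> quad_ext G u (Vertex v) = u v"
  by (simp add: quad_ext_def points_def)

lemma quad_ext_edge_pt:
  assumes "e \<in> edges G" and "0 < len G e" and "x \<in> {0..len G e}"
  shows "quad_ext G u (edge_pt G e x) = quad_interp (len G e) (u (tail G e)) (u (head G e)) x"
  using edge_pt_in_points[OF assms(1,3)] assms(2)
  by (auto simp: quad_ext_def edge_pt_def)

text \<open>Discrete summation by parts: each edge is met once at its tail and once at its head, a
  loop twice at the same vertex.\<close>

lemma sum_vertices_incident:
  fixes p q :: "'e \<Rightarrow> real"
  assumes "finite (edges G)"
  shows "(\<Sum>w\<in>vertices G. u w * ((\<Sum>e\<in>{e \<in> edges G. tail G e = w}. p e)
      - (\<Sum>e\<in>{e \<in> edges G. head G e = w}. q e))) =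
    (\<Sum>e\<in>edges G. u (tail G e) * p e - u (head G e) * q e)"
proof -
  have fin: "finite (vertices G)"
    using assms by (simp add: vertices_def)
  have 1: "(\<Sum>w\<in>vertices G. u w * (\<Sum>e\<in>{e \<in> edges G. t e = w}. r e)) =
      (\<Sum>e\<in>edges G. u (t e) * r e)"
    if "t ` edges G \<subseteq> vertices G" for t and r :: "'e \<Rightarrow> real"
  proof -
    have "u w * (\<Sum>e\<in>{e \<in> edges G. t e = w}. r e) =
        (\<Sum>e\<in>{e \<in> edges G. t e = w}. u (t e) * r e)" for w
      by (simp add: sum_distrib_left)
    then show ?thesis
      using sum.group[OF assms fin that, of "\<lambda>e. u (t e) * r e"] by simp
  qed
  show ?thesis
    by (subst right_diff_distrib, subst sum_subtractf, subst (1 2) 1)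
      (auto simp: vertices_def sum_subtractf)
qed

section \<open>The weighted graph Laplacian\<close>

definition laplacian :: "('v, 'e) metric_graph \<Rightarrow> ('v \<Rightarrow> real) \<Rightarrow> 'v \<Rightarrow> real" where
  "laplacian G u w =
     (\<Sum>e\<in>{e \<in> edges G. tail G e = w}. (u (head G e) - u (tail G e)) / len G e)
   - (\<Sum>e\<in>{e \<in> edges G. head G e = w}. (u (head G e) - u (tail G e)) / len G e)"

text \<open>Half of it is the total inward slope at \<open>w\<close> of the parabolas x (l - x) / 2
  on the incident edges.\<close>

definition weighted_degree :: "('v, 'e) metric_graph \<Rightarrow> 'v \<Rightarrow> real" where
  "weighted_degree G w = (\<Sum>e\<in>{e \<in> edges G. tail G e = w}. len G e)
     + (\<Sum>e\<in>{e \<in> edges G. head G e = w}. len G e)"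

lemma laplacian_linear:
  "laplacian G (\<lambda>w. u w + c * v w) w = laplacian G u w + c * laplacian G v w"
proof -
  have *: "(u (head G e) + c * v (head G e) - (u (tail G e) + c * v (tail G e))) / len G e =
      (u (head G e) - u (tail G e)) / len G e + c * ((v (head G e) - v (tail G e)) / len G e)" for e
    by (simp add: diff_divide_distrib add_divide_distrib algebra_simps)
  show ?thesis
    unfolding laplacian_def * sum.distrib right_diff_distrib sum_distrib_left
    by (rule add_diff_add)
qed

text \<open>Summation by parts turns the form into minus the sum of squared differences over edge
  lengths. If it vanishes, \<open>u\<close> agrees across every edge, hence is constant by
  connectedness, and its value on \<open>VD\<close> is zero. This serves both existence and
  uniqueness.\<close>

lemma laplacian_definite:
  assumes G: "compact_connected_metric_graph G"
    and VD: "VD \<noteq> {}" "VD \<subseteq> vertices G" "\<And>w. w \<in> VD \<Longrightarrow> u w = 0"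
    and 0: "(\<Sum>w\<in>vertices G - VD. u w * laplacian G u w) = 0"
  shows "\<forall>w\<in>vertices G. u w = 0"
proof -
  have fin: "finite (edges G)" and len: "\<And>e. e \<in> edges G \<Longrightarrow> 0 < len G e"
    using G by (auto simp: compact_connected_metric_graph_def)
  have finv: "finite (vertices G)"
    using fin by (simp add: vertices_def)
  have "(\<Sum>w\<in>vertices G. u w * laplacian G u w) = 0"
    using 0 sum.mono_neutral_left[OF finv, of "vertices G - VD" "\<lambda>w. u w * laplacian G u w"] VD(3)
    by auto
  moreover have "(\<Sum>w\<in>vertices G. u w * laplacian G u w) =
      (\<Sum>e\<in>edges G. u (tail G e) * ((u (head G e) - u (tail G e)) / len G e)
        - u (head G e) * ((u (head G e) - u (tail G e)) / len G e))"
    unfolding laplacian_def by (rule sum_vertices_incident[OF fin])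
  ultimately have "(\<Sum>e\<in>edges G. - ((u (head G e) - u (tail G e))\<^sup>2 / len G e)) = 0"
    by (simp add: power2_eq_square algebra_simps diff_divide_distrib add_divide_distrib)
  then have "(\<Sum>e\<in>edges G. (u (head G e) - u (tail G e))\<^sup>2 / len G e) = 0"
    by (simp add: sum_negf)
  then have "\<forall>e\<in>edges G. (u (head G e) - u (tail G e))\<^sup>2 / len G e = 0"
    by (subst (asm) sum_nonneg_eq_0_iff[OF fin]) (use len in \<open>auto simp: less_imp_le\<close>)
  then have "u (tail G e) = u (head G e)" if "e \<in> edges G" for e
    using len[OF that] that by force
  note eq = this
  obtain a where a: "a \<in> VD"
    using VD(1) by blast
  have "u w = u a" if "w \<in> vertices G" for w
    by (rule constant_on_vertices[OF G eq]) (use that a VD(2) in auto)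
  with VD(3)[OF a] show ?thesis
    by simp
qed

text \<open>Bordering: a positive definite system on \<open>insert w W\<close> is solved by two systems on \<open>W\<close>.\<close>

lemma definite_system_solvable:
  fixes L :: "('a \<Rightarrow> real) \<Rightarrow> 'a \<Rightarrow> real"
  assumes "finite W" and lin: "\<And>u c v i. L (\<lambda>j. u j + c * v j) i = L u i + c * L v i"
    and "\<And>u. (\<And>i. i \<notin> W \<Longrightarrow> u i = 0) \<Longrightarrow> (\<Sum>i\<in>W. u i * L u i) = 0 \<Longrightarrow> \<forall>i\<in>W. u i = 0"
  shows "\<exists>u. (\<forall>i. i \<notin> W \<longrightarrow> u i = 0) \<and> (\<forall>i\<in>W. L u i = b i)"
  using assms(1,3)
proof (induction W arbitrary: b)
  case empty
  show ?case by (intro exI[of _ "\<lambda>_. 0"]) simp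
next
  case (insert w W)
  \<comment> \<open>Definiteness passes to \<open>W\<close>: a vector supported in \<open>W\<close>
    vanishes at \<open>w\<close>, so the extra term of the form is zero.\<close>
  have "\<exists>u. (\<forall>i. i \<notin> W \<longrightarrow> u i = 0) \<and> (\<forall>i\<in>W. L u i = b i)" for b
  proof (rule insert.IH)
    fix u :: "'a \<Rightarrow> real"
    assume "\<And>i. i \<notin> W \<Longrightarrow> u i = 0" and "(\<Sum>i\<in>W. u i * L u i) = 0"
    then show "\<forall>i\<in>W. u i = 0"
      using insert.prems[of u] insert.hyps by auto
  qed
  note ex = this
  define d where "d = (\<lambda>j. if j = w then 1 else 0 :: real)"
  obtain p where p: "\<And>i. i \<notin> W \<Longrightarrow> p i = 0" "\<And>i. i \<in> W \<Longrightarrow> L p i = b i"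
    using ex[of b] by blast
  obtain q' where q': "\<And>i. i \<notin> W \<Longrightarrow> q' i = 0" "\<And>i. i \<in> W \<Longrightarrow> L q' i = - L d i"
    using ex[of "\<lambda>i. - L d i"] by blast
  \<comment> \<open>The unit vector at \<open>w\<close>, corrected on \<open>W\<close> so that
    \<open>L\<close> annihilates it there. The factor 1 fits the shape of
    \<open>lin\<close>.\<close>
  define q where "q = (\<lambda>j. q' j + 1 * d j)"
  have q: "L q i = 0" if "i \<in> W" for i
    using q'(2)[OF that] unfolding q_def lin by simp
  have qw: "q w = 1" and qout: "\<And>i. i \<notin> insert w W \<Longrightarrow> q i = 0"
    using q'(1) insert.hyps by (auto simp: q_def d_def)
  \<comment> \<open>The Schur complement: were it zero, \<open>q\<close> would be a nonzero vector
    on which the form vanishes.\<close>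
  have "L q w \<noteq> 0"
  proof
    assume "L q w = 0"
    then have "(\<Sum>i\<in>insert w W. q i * L q i) = 0"
      using q by (intro sum.neutral) auto
    with insert.prems[of q] qout qw show False
      by auto
  qed
  \<comment> \<open>Adding a multiple of \<open>q\<close> leaves the equations on \<open>W\<close>
    intact and adjusts only the one at \<open>w\<close>.\<close>
  define c where "c = (b w - L p w) / L q w"
  have "L (\<lambda>j. p j + c * q j) i = b i" if "i \<in> insert w W" for i
    unfolding lin using that p(2) q \<open>L q w \<noteq> 0\<close> by (auto simp: c_def)
  moreover have "p i + c * q i = 0" if "i \<notin> insert w W" for i
    using that p(1) qout by simp
  ultimately show ?case
    by (intro exI[of _ "\<lambda>j. p j + c * q j"]) simp
qed

subsection \<open>The torsion function\<close>

lemma quad_ext_weak_deriv: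
  fixes G :: "('v, 'e) metric_graph" and u :: "'v \<Rightarrow> real"
  assumes "e \<in> edges G" and "0 < len G e"
  defines "l \<equiv> len G e" and "s \<equiv> u (tail G e)" and "t \<equiv> u (head G e)"
  shows "has_weak_deriv l (\<lambda>x. quad_ext G u (edge_pt G e x)) (\<lambda>x. (t - s) / l + l / 2 - x)"
    and "has_weak_deriv l (\<lambda>x. (t - s) / l + l / 2 - x) (\<lambda>x. - 1)"
    and "(\<lambda>x. (t - s) / l + l / 2 - x) \<in> L2 l"
    and "continuous_on {0..l} (\<lambda>x. quad_ext G u (edge_pt G e x))"
proof -
  have l: "0 < l"
    using assms(2) by (simp add: l_def)
  have eq: "quad_ext G u (edge_pt G e x) = quad_interp l s t x" if "x \<in> {0..l}" for x
    using quad_ext_edge_pt[OF assms(1,2)] that by (simp add: l_def s_def t_def)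
  show "has_weak_deriv l (\<lambda>x. quad_ext G u (edge_pt G e x)) (\<lambda>x. (t - s) / l + l / 2 - x)"
  proof (rule has_weak_deriv_classical)
    fix x assume x: "x \<in> {0..l}"
    have "((\<lambda>x. quad_ext G u (edge_pt G e x)) has_vector_derivative (t - s) / l + l / 2 - x)
        (at x within {0..l})"
      by (rule has_vector_derivative_transform[OF x eq
            quad_interp_deriv[OF l, unfolded has_real_derivative_iff_has_vector_derivative]])
    then show "((\<lambda>x. quad_ext G u (edge_pt G e x)) has_real_derivative (t - s) / l + l / 2 - x)
        (at x within {0..l})"
      by (simp add: has_real_derivative_iff_has_vector_derivative)
  qed (use l in \<open>auto intro!: continuous_intros\<close>)
  show "has_weak_deriv l (\<lambda>x. (t - s) / l + l / 2 - x) (\<lambda>x. - 1)"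
    by (rule has_weak_deriv_classical) (use l in \<open>auto intro!: derivative_eq_intros\<close>)
  show "(\<lambda>x. (t - s) / l + l / 2 - x) \<in> L2 l"
    by (intro continuous_on_imp_L2 continuous_intros)
  show "continuous_on {0..l} (\<lambda>x. quad_ext G u (edge_pt G e x))"
    using continuous_on_quad_interp[OF l] by (subst continuous_on_cong[OF refl eq])
qed

lemma quad_ext_in_H10:
  assumes "\<And>e. e \<in> edges G \<Longrightarrow> 0 < len G e" and "VD \<subseteq> vertices G"
    and "\<And>w. w \<in> VD \<Longrightarrow> u w = 0"
  shows "quad_ext G u \<in> H10 G VD"
proof -
  have "(\<lambda>x. quad_ext G u (edge_pt G e x)) \<in> H1 (len G e)" if e: "e \<in> edges G" for e
    using quad_ext_weak_deriv[OF e assms(1)[OF e], of u] continuous_on_imp_L2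
    unfolding H1_def by blast
  moreover have "quad_ext G u \<in> extensional (points G)"
    by (simp add: quad_ext_def)
  moreover have "quad_ext G u (Vertex w) = 0" if "w \<in> VD" for w
    using quad_ext_Vertex[of w G u] assms(2,3) that by auto
  ultimately show ?thesis
    using quad_ext_weak_deriv(4)[OF _ assms(1)] by (simp add: H10_def continuous_map_graph_iff)
qed

text \<open>The slopes at the two ends are the difference quotient plus and minus half the length.
  As the head sum is subtracted, the half lengths add up while the quotients form the
  Laplacian.\<close>

lemma normal_derivative_sum_quad_ext:
  assumes "\<And>e. e \<in> edges G \<Longrightarrow> 0 < len G e"
  shows "normal_derivative_sum G (quad_ext G u) w = laplacian G u w + weighted_degree G w / 2"
proof -
  have vd: "vector_derivative (\<lambda>x. quad_ext G u (edge_pt G e x)) (at x within {0..len G e}) =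
      (u (head G e) - u (tail G e)) / len G e + len G e / 2 - x"
    if e: "e \<in> edges G" and x: "x \<in> {0..len G e}" for e x
  proof -
    note l = assms[OF e]
    show ?thesis
      by (rule vector_derivative_within_closed_interval[OF l x],
          rule has_vector_derivative_transform[OF x quad_ext_edge_pt[OF e l]
            quad_interp_deriv[OF l, unfolded has_real_derivative_iff_has_vector_derivative]])
  qed
  have "(\<Sum>e\<in>{e \<in> edges G. tail G e = w}.
        vector_derivative (\<lambda>x. quad_ext G u (edge_pt G e x)) (at 0 within {0..len G e})) =
      (\<Sum>e\<in>{e \<in> edges G. tail G e = w}. (u (head G e) - u (tail G e)) / len G e + len G e / 2)"
    by (rule sum.cong[OF refl]) (use assms vd in \<open>force simp: less_imp_le\<close>)
  moreover have "(\<Sum>e\<in>{e \<in> edges G. head G e = w}.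
        vector_derivative (\<lambda>x. quad_ext G u (edge_pt G e x)) (at (len G e) within {0..len G e})) =
      (\<Sum>e\<in>{e \<in> edges G. head G e = w}. (u (head G e) - u (tail G e)) / len G e - len G e / 2)"
    by (rule sum.cong[OF refl]) (use assms vd in \<open>force simp: less_imp_le\<close>)
  ultimately show ?thesis
    by (simp only: normal_derivative_sum_def laplacian_def weighted_degree_def sum.distrib
        sum_subtractf sum_divide_distrib[symmetric]) argo
qed

definition solves_torsion_system ::
  "('v, 'e) metric_graph \<Rightarrow> 'v set \<Rightarrow> ('v \<Rightarrow> real) \<Rightarrow> bool" where
  "solves_torsion_system G VD u \<longleftrightarrow> (\<forall>w\<in>VD. u w = 0) \<and>
     (\<forall>w\<in>vertices G - VD. laplacian G u w + weighted_degree G w / 2 = 0)"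

text \<open>Reduces the boundary value problem to finitely many linear equations: weak regularity
  fixes each edge component, and the Kirchhoff conditions become the vertex equations.\<close>

lemma is_torsion_function_iff:
  assumes G: "compact_connected_metric_graph G" and VD: "VD \<subseteq> vertices G"
  shows "is_torsion_function G VD v \<longleftrightarrow> (\<exists>u. v = quad_ext G u \<and> solves_torsion_system G VD u)"
proof
  have len: "0 < len G e" if "e \<in> edges G" for e
    using G that by (auto simp: compact_connected_metric_graph_def)
  note nds = normal_derivative_sum_quad_ext[OF len]
  {
    assume v: "is_torsion_function G VD v"
    define u where "u w = v (Vertex w)" for w
    have H: "v \<in> H10 G VD"
      using v by (simp add: is_torsion_function_def)
    have edge: "v (edge_pt G e x) = quad_interp (len G e) (u (tail G e)) (u (head G e)) x"
      if e: "e \<in> edges G" and x: "x \<in> {0..len G e}" for e x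
    proof -
      obtain g where "has_weak_deriv (len G e) (\<lambda>x. v (edge_pt G e x)) g"
        "has_weak_deriv (len G e) g (\<lambda>x. - 1)"
        using v e unfolding is_torsion_function_def by blast
      moreover have "continuous_on {0..len G e} (\<lambda>x. v (edge_pt G e x))"
        using H e unfolding H10_def continuous_map_graph_iff by blast
      ultimately have "v (edge_pt G e x) =
          quad_interp (len G e) (v (edge_pt G e 0)) (v (edge_pt G e (len G e))) x"
        using weak_torsion_quadratic[OF len[OF e]] x by blast
      then show ?thesis
        using len[OF e] by (simp add: u_def edge_pt_def)
    qed
    have "v p = quad_ext G u p" for p
    proof (cases "p \<in> points G")
      case False
      then show ?thesis
        using H by (simp add: H10_def quad_ext_def extensional_def)
    next
      case True
      then consider w where "p = Vertex w" "w \<in> vertices G"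
        | e x where "p = Inner e x" "e \<in> edges G" "0 < x" "x < len G e"
        unfolding points_def by blast
      then show ?thesis
      proof cases
        case 1
        then show ?thesis
          by (simp add: quad_ext_Vertex u_def)
      next
        case 2
        then have "p = edge_pt G e x"
          by (simp add: edge_pt_def)
        then show ?thesis
          using edge[of e x] quad_ext_edge_pt[of e G x u] len[of e] 2 by simp
      qed
    qed
    then have "v = quad_ext G u"
      by (rule ext)
    moreover have "solves_torsion_system G VD u"
      unfolding solves_torsion_system_def
    proof (intro conjI ballI)
      fix w assume "w \<in> VD"
      then show "u w = 0"
        using H by (simp add: H10_def u_def)
    next
      fix w assume "w \<in> vertices G - VD"
      then have "normal_derivative_sum G v w = 0"
        using v by (simp add: is_torsion_function_def)
      then show "laplacian G u w + weighted_degree G w / 2 = 0"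
        by (simp only: \<open>v = quad_ext G u\<close> nds)
    qed
    ultimately show "\<exists>u. v = quad_ext G u \<and> solves_torsion_system G VD u"
      by blast
  }
  {
    assume "\<exists>u. v = quad_ext G u \<and> solves_torsion_system G VD u"
    then obtain u where v: "v = quad_ext G u" and u: "solves_torsion_system G VD u"
      by blast
    have "v \<in> H10 G VD"
      unfolding v by (rule quad_ext_in_H10[OF len VD]) (use u in \<open>auto simp: solves_torsion_system_def\<close>)
    moreover have "\<exists>g\<in>H1 (len G e). has_weak_deriv (len G e) (\<lambda>x. v (edge_pt G e x)) g \<and>
        has_weak_deriv (len G e) g (\<lambda>x. - 1)" if e: "e \<in> edges G" for e
    proof -
      note * = quad_ext_weak_deriv[OF e len[OF e], of u]
      have "(\<lambda>x. - 1) \<in> L2 (len G e)"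
        by (intro continuous_on_imp_L2 continuous_intros)
      then show ?thesis
        using *(1-3) unfolding v H1_def by blast
    qed
    ultimately show "is_torsion_function G VD v"
      using u nds v unfolding is_torsion_function_def solves_torsion_system_def by simp
  }
qed

lemma torsion_function_eq_quad_ext:
  assumes G: "compact_connected_metric_graph G" and VD: "VD \<noteq> {}" "VD \<subseteq> vertices G"
  obtains u where "torsion_function G VD = quad_ext G u" and "solves_torsion_system G VD u"
proof -
  have fin: "finite (edges G)"
    using G by (simp add: compact_connected_metric_graph_def)
  then have finv: "finite (vertices G)"
    by (simp add: vertices_def)
  \<comment> \<open>Requiring the unknowns to vanish off the free vertices encodes the Dirichlet
    condition.\<close>
  have "\<exists>u. (\<forall>i. i \<notin> vertices G - VD \<longrightarrow> u i = 0) \<and>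
      (\<forall>i\<in>vertices G - VD. laplacian G u i = - weighted_degree G i / 2)"
  proof (rule definite_system_solvable)
    fix u :: "'a \<Rightarrow> real"
    assume "\<And>i. i \<notin> vertices G - VD \<Longrightarrow> u i = 0"
      and "(\<Sum>i\<in>vertices G - VD. u i * laplacian G u i) = 0"
    then have "\<forall>w\<in>vertices G. u w = 0"
      by (intro laplacian_definite[OF G VD]) auto
    then show "\<forall>i\<in>vertices G - VD. u i = 0"
      by blast
  next
    show "finite (vertices G - VD)"
      using finv by simp
  qed (rule laplacian_linear)
  then obtain u where "\<And>i. i \<notin> vertices G - VD \<Longrightarrow> u i = 0"
    and "\<And>i. i \<in> vertices G - VD \<Longrightarrow> laplacian G u i = - weighted_degree G i / 2"
    by blast
  then have u: "solves_torsion_system G VD u"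
    by (simp add: solves_torsion_system_def)
  have "torsion_function G VD = quad_ext G u"
    unfolding torsion_function_def
  proof (rule the_equality)
    show "is_torsion_function G VD (quad_ext G u)"
      using u by (auto simp: is_torsion_function_iff[OF G VD(2)])
  next
    fix v assume "is_torsion_function G VD v"
    then obtain u' where v: "v = quad_ext G u'" and u': "solves_torsion_system G VD u'"
      by (auto simp: is_torsion_function_iff[OF G VD(2)])
    \<comment> \<open>The difference of two solutions solves the homogeneous system; it is written
      in the shape of \<open>laplacian_linear\<close>.\<close>
    define d where "d = (\<lambda>w. u' w + - 1 * u w)"
    have "\<forall>w\<in>vertices G. d w = 0"
    proof (rule laplacian_definite[OF G VD])
      show "d w = 0" if "w \<in> VD" for w
        using u u' that by (simp add: d_def solves_torsion_system_def)
      have "laplacian G d w = 0" if "w \<in> vertices G - VD" for w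
      proof -
        have "laplacian G u' w + weighted_degree G w / 2 = 0" "laplacian G u w + weighted_degree G w / 2 = 0"
          using u u' that by (simp_all add: solves_torsion_system_def)
        then show ?thesis
          unfolding d_def laplacian_linear by linarith
      qed
      then show "(\<Sum>w\<in>vertices G - VD. d w * laplacian G d w) = 0"
        by simp
    qed
    then have "u' w = u w" if "w \<in> vertices G" for w
      using that by (simp add: d_def)
    \<comment> \<open>\<open>u'\<close> and \<open>u\<close> may differ off the vertices, but the
      extension sees only vertex values.\<close>
    then show "v = quad_ext G u"
      unfolding v quad_ext_def
      by (intro restrict_ext) (auto simp: points_def vertices_def)
  qed
  from this u show ?thesis
    by (rule that)
qed


subsection \<open>The inequality\<close>

text \<open>All quotients are nonnegative, so the infimum is a genuine lower bound.\<close>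

lemma lambda1_le_Rayleigh:
  assumes "f \<in> H10 G VD" and "\<exists>p\<in>points G. f p \<noteq> 0"
    and "\<And>e. e \<in> edges G \<Longrightarrow> g e \<in> L2 (len G e)"
    and "\<And>e. e \<in> edges G \<Longrightarrow> has_weak_deriv (len G e) (\<lambda>x. f (edge_pt G e x)) (g e)"
  shows "lambda1 G VD \<le> (\<Sum>e\<in>edges G. integral\<^sup>L (lebesgue_on {0..len G e}) (\<lambda>x. (g e x)\<^sup>2))
    / graph_integral G (\<lambda>p. (f p)\<^sup>2)"
  unfolding lambda1_def
proof (rule cInf_lower)
  show "bdd_below {(\<Sum>e\<in>edges G. integral\<^sup>L (lebesgue_on {0..len G e}) (\<lambda>x. (g e x)\<^sup>2))
        / graph_integral G (\<lambda>p. (f p)\<^sup>2) | f g.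
      f \<in> H10 G VD \<and> (\<exists>p\<in>points G. f p \<noteq> 0) \<and>
      (\<forall>e\<in>edges G. g e \<in> L2 (len G e) \<and>
         has_weak_deriv (len G e) (\<lambda>x. f (edge_pt G e x)) (g e))}"
    by (rule bdd_belowI[of _ 0]) (auto simp: graph_integral_def intro!: divide_nonneg_nonneg sum_nonneg)
qed (use assms in blast)

text \<open>The difference of the two sides is \<open>|G|\<close> times the integral of \<open>(v - m)\<^sup>2\<close>, where \<open>m\<close> is the
  mean of \<open>v\<close>, and \<open>v\<close> is strictly concave on every edge.\<close>

lemma square_graph_integral_quad_ext_less:
  fixes G :: "('v, 'e) metric_graph" and u :: "'v \<Rightarrow> real"
  assumes fin: "finite (edges G)" and ne: "edges G \<noteq> {}"
    and len: "\<And>e. e \<in> edges G \<Longrightarrow> 0 < len G e"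
  defines "v \<equiv> quad_ext G u"
  shows "(graph_integral G v)\<^sup>2 < total_length G * graph_integral G (\<lambda>p. (v p)\<^sup>2)"
proof -
  have L: "total_length G > 0"
    unfolding total_length_def using fin ne len by (intro sum_pos)
  define m where "m = graph_integral G v / total_length G"
  have cont: "continuous_on {0..len G e} (\<lambda>x. v (edge_pt G e x))" if "e \<in> edges G" for e
    unfolding v_def by (rule quad_ext_weak_deriv(4)[OF that len[OF that]])
  have "0 < (\<Sum>e\<in>edges G. integral\<^sup>L (lebesgue_on {0..len G e}) (\<lambda>x. (v (edge_pt G e x) - m)\<^sup>2))"
  proof (rule sum_pos[OF fin ne])
    fix e assume e: "e \<in> edges G"
    have "integral\<^sup>L (lebesgue_on {0..len G e}) (\<lambda>x. (v (edge_pt G e x) - m)\<^sup>2) \<noteq> 0"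
    proof
      assume "integral\<^sup>L (lebesgue_on {0..len G e}) (\<lambda>x. (v (edge_pt G e x) - m)\<^sup>2) = 0"
      then have "\<forall>x\<in>{0..len G e}. (v (edge_pt G e x) - m)\<^sup>2 = 0"
        by (subst (asm) integralL_eq_0_iff) (use len[OF e] cont[OF e] in \<open>auto intro!: continuous_intros\<close>)
      then have "\<forall>x\<in>{0..len G e}. quad_interp (len G e) (u (tail G e)) (u (head G e)) x = m"
        using quad_ext_edge_pt[OF e len[OF e], of _ u] by (simp add: v_def)
      then show False
        by (rule quad_interp_not_constant[OF len[OF e]])
    qed
    then show "0 < integral\<^sup>L (lebesgue_on {0..len G e}) (\<lambda>x. (v (edge_pt G e x) - m)\<^sup>2)"
      by (simp add: order_less_le)
  qed
  also have "\<dots> = (\<Sum>e\<in>edges G. integral\<^sup>L (lebesgue_on {0..len G e}) (\<lambda>x. (v (edge_pt G e x))\<^sup>2)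
      - 2 * m * integral\<^sup>L (lebesgue_on {0..len G e}) (\<lambda>x. v (edge_pt G e x)) + m\<^sup>2 * len G e)"
  proof (rule sum.cong[OF refl])
    fix e assume e: "e \<in> edges G"
    let ?I = "integral\<^sup>L (lebesgue_on {0..len G e})"
    let ?f = "\<lambda>x. v (edge_pt G e x)"
    have "?I (\<lambda>x. (?f x - m)\<^sup>2) = ?I (\<lambda>x. ((?f x)\<^sup>2 - 2 * m * ?f x) + m\<^sup>2)"
      by (simp add: power2_eq_square algebra_simps)
    also have "\<dots> = ?I (\<lambda>x. (?f x)\<^sup>2 - 2 * m * ?f x) + ?I (\<lambda>x. m\<^sup>2)"
      by (intro Bochner_Integration.integral_add continuous_imp_integrable_real continuous_intros
          cont[OF e])
    also have "?I (\<lambda>x. (?f x)\<^sup>2 - 2 * m * ?f x) = ?I (\<lambda>x. (?f x)\<^sup>2) - ?I (\<lambda>x. 2 * m * ?f x)"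
      by (intro Bochner_Integration.integral_diff continuous_imp_integrable_real continuous_intros
          cont[OF e])
    also have "?I (\<lambda>x. m\<^sup>2) = m\<^sup>2 * len G e"
      using lebesgue_on_FTC[of 0 "len G e" "\<lambda>x. m\<^sup>2" "\<lambda>x. m\<^sup>2 * x"] len[OF e]
      by (auto intro!: derivative_eq_intros)
    finally show "?I (\<lambda>x. (?f x - m)\<^sup>2) = ?I (\<lambda>x. (?f x)\<^sup>2) - 2 * m * ?I ?f + m\<^sup>2 * len G e"
      by simp
  qed
  also have "\<dots> = graph_integral G (\<lambda>p. (v p)\<^sup>2) - 2 * m * graph_integral G v + m\<^sup>2 * total_length G"
    by (simp add: graph_integral_def total_length_def sum.distrib sum_subtractf sum_distrib_left)
  also have "\<dots> = graph_integral G (\<lambda>p. (v p)\<^sup>2) - (graph_integral G v)\<^sup>2 / total_length G"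
    using L by (simp add: m_def power2_eq_square field_simps)
  finally show ?thesis
    using L by (simp add: field_simps)
qed

theorem proposition5p1:
  fixes G :: "('v, 'e) metric_graph" and VD :: "'v set"
  assumes "compact_connected_metric_graph G"
    and "VD \<noteq> {}" and "VD \<subseteq> vertices G"
  shows "lambda1 G VD * torsional_rigidity G VD < total_length G"
proof -
  have fin: "finite (edges G)" and len: "\<And>e. e \<in> edges G \<Longrightarrow> 0 < len G e"
    using assms(1) by (auto simp: compact_connected_metric_graph_def)
  have ne: "edges G \<noteq> {}"
    using assms(2,3) by (auto simp: vertices_def)
  obtain u where v: "torsion_function G VD = quad_ext G u" and u: "solves_torsion_system G VD u"
    using torsion_function_eq_quad_ext[OF assms] .
  define T where "T = torsional_rigidity G VD"
  define S where "S = graph_integral G (\<lambda>p. (quad_ext G u p)\<^sup>2)"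
  have T: "T = graph_integral G (quad_ext G u)"
    by (simp add: T_def torsional_rigidity_def v)
  define D where "D e x = (u (head G e) - u (tail G e)) / len G e + len G e / 2 - x" for e x
  let ?I = "\<lambda>e. integral\<^sup>L (lebesgue_on {0..len G e})"
  let ?c = "\<lambda>e. (u (head G e) - u (tail G e)) / len G e"
  \<comment> \<open>The endpoint terms of the energy identity. Grouped by vertex they are
    \<open>u w\<close> times the normal derivative sum, and one of the two factors is always
    zero.\<close>
  have "(\<Sum>e\<in>edges G. u (tail G e) * (?c e + len G e / 2) - u (head G e) * (?c e - len G e / 2)) =
      (\<Sum>w\<in>vertices G. u w * ((\<Sum>e\<in>{e \<in> edges G. tail G e = w}. ?c e + len G e / 2)
      - (\<Sum>e\<in>{e \<in> edges G. head G e = w}. ?c e - len G e / 2)))"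
    by (rule sum_vertices_incident[OF fin, symmetric])
  also have "\<dots> = (\<Sum>w\<in>vertices G. u w * (laplacian G u w + weighted_degree G w / 2))"
    by (rule sum.cong[OF refl], rule arg_cong[where f = "(*) _"])
      (simp only: laplacian_def weighted_degree_def sum.distrib sum_subtractf
        sum_divide_distrib[symmetric], argo)
  also have "\<dots> = 0"
    by (rule sum.neutral) (use u in \<open>force simp: solves_torsion_system_def\<close>)
  finally have flux: "(\<Sum>e\<in>edges G.
      u (tail G e) * (?c e + len G e / 2) - u (head G e) * (?c e - len G e / 2)) = 0" .
  have "?I e (\<lambda>x. (D e x)\<^sup>2) = ?I e (\<lambda>x. quad_ext G u (edge_pt G e x))
      - (u (tail G e) * (?c e + len G e / 2) - u (head G e) * (?c e - len G e / 2))"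
    if e: "e \<in> edges G" for e
  proof -
    have "?I e (\<lambda>x. quad_ext G u (edge_pt G e x)) =
        ?I e (quad_interp (len G e) (u (tail G e)) (u (head G e)))"
      by (rule Bochner_Integration.integral_cong) (use quad_ext_edge_pt[OF e len[OF e]] in auto)
    then show ?thesis
      using integral_deriv_quad_interp_square[OF len[OF e], of "u (head G e)" "u (tail G e)"]
      by (simp add: D_def)
  qed
  then have energy: "(\<Sum>e\<in>edges G. ?I e (\<lambda>x. (D e x)\<^sup>2)) = T"
    using flux by (simp add: T graph_integral_def sum_subtractf)
  \<comment> \<open>The sign of T is read off the energy, with no maximum principle for v.\<close>
  have T0: "0 \<le> T"
    unfolding energy[symmetric] by (intro sum_nonneg integral_nonneg_AE) simp
  have less: "T\<^sup>2 < total_length G * S"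
    unfolding T S_def by (rule square_graph_integral_quad_ext_less[OF fin ne len])
  have "0 < total_length G"
    unfolding total_length_def using fin ne len by (intro sum_pos)
  \<comment> \<open>The strict Cauchy-Schwarz bound also shows that the denominator is positive, and
    hence that v is an admissible nonzero test function.\<close>
  moreover have "0 < total_length G * S"
    using less by (rule le_less_trans[OF zero_le_power2])
  ultimately have S: "0 < S"
    by (simp add: zero_less_mult_iff)
  have "\<exists>p\<in>points G. quad_ext G u p \<noteq> 0"
  proof (rule ccontr)
    assume "\<not> ?thesis"
    then have "?I e (\<lambda>x. (quad_ext G u (edge_pt G e x))\<^sup>2) = ?I e (\<lambda>x. 0)" if "e \<in> edges G" for e
      using edge_pt_in_points[OF that] by (intro Bochner_Integration.integral_cong) auto
    then have "S = 0"
      by (simp add: S_def graph_integral_def)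
    with S show False
      by simp
  qed
  then have "lambda1 G VD \<le> T / S"
    unfolding energy[symmetric] S_def
    by (intro lambda1_le_Rayleigh quad_ext_in_H10 len assms(3))
      (use u quad_ext_weak_deriv(1,3)[OF _ len] in \<open>auto simp: solves_torsion_system_def D_def\<close>)
  then have "lambda1 G VD * T \<le> T / S * T"
    using T0 by (rule mult_right_mono)
  also have "\<dots> < total_length G"
    using less S by (simp add: power2_eq_square field_simps)
  finally show ?thesis
    by (simp add: T_def)
qed

end
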